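(* Let $\epsilon>0$ be sufficiently small. In the distributed streaming model with $k\ge 2$ sites, any deterministic algorithm that continuously tracks an $\epsilon$-approximate median must incur (in the worst case over input sequences of $n$ items) a total communication cost of $\Omega\!\left(\frac{k}{\epsilon}\log n\right)$.
   Context: Distributed streaming model: a sequence $A=(a_1,\dots,a_n)$ of items from the universe $U=\{1,\dots,u\}$ arrives over time; item $a_i$ arrives at time $t_i$ ($t_1<\dots<t_n$) at exactly one of $k$ sites $S_1,\dots,S_k$. Each site has a two-way communication channel with a designated coordinator $C$ (no direct site-to-site communication). A site may initiate communication (or change its local state) only upon the arrival of an item at it or in response to the coordinator; communication is instantaneous. $A(t)$ denotes the multiset of items arrived up to time $t$. Communication cost is measured in words of $\Theta(\log n)$ bits. A $\phi$-quantile of $A$ is an $x\in U$ such that at most $\phi|A|$ items of $A$ are smaller than $x$ and at most $(1-\phi)|A|$ are greater than $x$; the median is the $1/2$-quantile, and an $\epsilon$-approximate median is any $\phi'$-quantile with $1/2-\epsilon\le\phi'\le 1/2+\epsilon$. Tracking means the coordinator holds such an element for $A(t)$ at every time $t$. *)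

theory Defs
  imports
    Complex_Main
    "HOL-Library.Multiset"
    "HOL-Library.Landau_Symbols"
    "HOL-Library.While_Combinator"
begin

definition is_quantile :: "real \<Rightarrow> nat \<Rightarrow> nat multiset \<Rightarrow> nat \<Rightarrow> bool" where
  "is_quantile \<phi> u A x \<longleftrightarrow> x \<in> {1..u} \<and>
     real (size {#y \<in># A. y < x#}) \<le> \<phi> * real (size A) \<and>
     real (size {#y \<in># A. x < y#}) \<le> (1 - \<phi>) * real (size A)"

definition approx_median :: "real \<Rightarrow> nat \<Rightarrow> nat multiset \<Rightarrow> nat \<Rightarrow> bool" where
  "approx_median \<epsilon> u A x \<longleftrightarrow> (\<exists>\<phi>. 1/2 - \<epsilon> \<le> \<phi> \<and> \<phi> \<le> 1/2 + \<epsilon> \<and> is_quantile \<phi> u A x)"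


text \<open>
  A message is a nonempty sequence of words, a word of \<open>b\<close> bits being a number below \<open>2 ^ b\<close>.
  The cost of a message is its length, so even a message that carries a single bit costs one word.
\<close>

type_synonym message = "nat list"

definition is_message :: "nat \<Rightarrow> message \<Rightarrow> bool" where
  "is_message b m \<longleftrightarrow> m \<noteq> [] \<and> (\<forall>x\<in>set m. x < 2 ^ b)"

text \<open>
  The local state of a party is taken to be its complete local history (oldest event first): the
  items and messages received by a site, or the messages received by the coordinator together
  with their senders. The messages a party has sent itself are determined by this history. Every
  deterministic state machine, whatever its state space, is an instance, because its state is a
  function of the history; there are no other inputs such as a clock or random bits.

  \<open>site_send P i h\<close> are the messages that site \<open>i\<close> sends to the coordinator in reaction to the last
  event of \<open>h\<close>; \<open>coord_send P h\<close> are the messages, paired with the receiving sites, that the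
  coordinator sends in reaction to the last message of \<open>h\<close>; \<open>coord_out P h\<close> is the element that
  the coordinator holds.
\<close>

datatype event = Item nat | Received message

record protocol =
  site_send :: "nat \<Rightarrow> event list \<Rightarrow> message list"
  coord_send :: "(nat \<times> message) list \<Rightarrow> (nat \<times> message) list"
  coord_out :: "(nat \<times> message) list \<Rightarrow> nat"

definition well_formed :: "nat \<Rightarrow> nat \<Rightarrow> protocol \<Rightarrow> bool" where
  "well_formed k b P \<longleftrightarrow>
     (\<forall>i\<in>{1..k}. \<forall>h. \<forall>m\<in>set (site_send P i h). is_message b m) \<and>
     (\<forall>h. \<forall>(i, m)\<in>set (coord_send P h). i \<in> {1..k} \<and> is_message b m)"


datatype transmission = To_Coord nat message | To_Site nat message

fun cost :: "transmission \<Rightarrow> nat" where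
  "cost (To_Coord i m) = length m"
| "cost (To_Site i m) = length m"

text \<open>
  \<open>in_flight\<close> is the queue of messages sent but not yet delivered; \<open>total_cost\<close> is the number of
  words sent so far, in both directions and by all parties.
\<close>

record config =
  site_hist :: "nat \<Rightarrow> event list"
  coord_hist :: "(nat \<times> message) list"
  in_flight :: "transmission list"
  total_cost :: nat

definition init :: config where
  "init = \<lparr>site_hist = (\<lambda>_. []), coord_hist = [], in_flight = [], total_cost = 0\<rparr>"

definition transmit :: "transmission list \<Rightarrow> config \<Rightarrow> config" where
  "transmit ts c = c\<lparr>in_flight := in_flight c @ ts,
                      total_cost := total_cost c + sum_list (map cost ts)\<rparr>"

definition site_event :: "protocol \<Rightarrow> nat \<Rightarrow> event \<Rightarrow> config \<Rightarrow> config" where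
  "site_event P i e c =
     (let h = site_hist c i @ [e]
      in transmit (map (To_Coord i) (site_send P i h))
           (c\<lparr>site_hist := (site_hist c)(i := h)\<rparr>))"

definition coord_event :: "protocol \<Rightarrow> nat \<Rightarrow> message \<Rightarrow> config \<Rightarrow> config" where
  "coord_event P i m c =
     (let h = coord_hist c @ [(i, m)]
      in transmit (map (\<lambda>(j, m'). To_Site j m') (coord_send P h)) (c\<lparr>coord_hist := h\<rparr>))"

fun deliver :: "protocol \<Rightarrow> transmission \<Rightarrow> config \<Rightarrow> config" where
  "deliver P (To_Coord i m) c = coord_event P i m c"
| "deliver P (To_Site i m) c = site_event P i (Received m) c"

text \<open>
  Communication is instantaneous: after an arrival, messages are delivered in the order in which
  they were sent until none is left, before the next item arrives. The result is \<open>None\<close> if this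
  never happens.
\<close>

definition exchange :: "protocol \<Rightarrow> config \<Rightarrow> config option" where
  "exchange P = while_option (\<lambda>c. in_flight c \<noteq> [])
     (\<lambda>c. deliver P (hd (in_flight c)) (c\<lparr>in_flight := tl (in_flight c)\<rparr>))"

text \<open>
  An input lists, in order of arrival, the items with the sites at which they arrive. The arrival
  times themselves are irrelevant, as the parties react to events only.
\<close>

definition inputs :: "nat \<Rightarrow> nat \<Rightarrow> nat \<Rightarrow> (nat \<times> nat) list set" where
  "inputs k u n = {xs. length xs = n \<and> set xs \<subseteq> {1..u} \<times> {1..k}}"

definition run :: "protocol \<Rightarrow> (nat \<times> nat) list \<Rightarrow> config option" where
  "run P xs =
     foldl (\<lambda>r (a, i). Option.bind r (\<lambda>c. exchange P (site_event P i (Item a) c))) (Some init) xs"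

definition tracks_median :: "nat \<Rightarrow> nat \<Rightarrow> real \<Rightarrow> nat \<Rightarrow> protocol \<Rightarrow> bool" where
  "tracks_median k u \<epsilon> n P \<longleftrightarrow>
     (\<forall>xs\<in>inputs k u n. \<forall>t\<le>n. \<exists>c. run P (take t xs) = Some c \<and>
        approx_median \<epsilon> u (mset (map fst (take t xs))) (coord_out P (coord_hist c)))"

end

theory Submission
  imports Defs "HOL-Real_Asymp.Real_Asymp"
begin

text \<open>
  Only the items 1 and 2 are needed. The adversary always inserts the item opposite to the element
  \<open>v\<close> that the coordinator holds. After \<open>m\<close> items, some \<open>O(\<epsilon> m + 1)\<close> further copies of \<open>3 - v\<close> make
  \<open>v\<close> invalid. If every site could absorb its share \<open>q = O(\<epsilon> m / k + 1)\<close> of them silently, the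
  coordinator would keep holding \<open>v\<close>; hence some site sends a message after at most \<open>q\<close> copies, and
  the adversary gives it just these. So one message is sent each time the length \<open>m\<close> grows by a
  factor \<open>1 + O(\<epsilon> / k)\<close> (up to an additive constant), that is \<open>\<Omega>(k / \<epsilon> * ln n)\<close> messages in total.
\<close>

subsection \<open>Runs\<close>

lemma total_cost_deliver:
  "total_cost c \<le> total_cost (deliver P t (c\<lparr>in_flight := q\<rparr>))"
  by (cases t) (simp_all add: coord_event_def site_event_def transmit_def Let_def)

lemma exchange_SomeD:
  assumes "exchange P c = Some c'"
  shows "in_flight c' = []" "total_cost c \<le> total_cost c'"
proof -
  show "in_flight c' = []"
    using while_option_stop[OF assms[unfolded exchange_def]] by simp
  show "total_cost c \<le> total_cost c'"
    by (rule while_option_rule[OF _ assms[unfolded exchange_def],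
          where P = "\<lambda>d. total_cost c \<le> total_cost d"])
      (use total_cost_deliver order_trans in blast)+
qed

lemma exchange_quiescent: "in_flight c = [] \<Longrightarrow> exchange P c = Some c"
  by (simp add: exchange_def while_option_unfold)

lemma run_Nil: "run P [] = Some init"
  by (simp add: run_def)

lemma run_snoc:
  "run P (xs @ [(a, i)]) = Option.bind (run P xs) (\<lambda>c. exchange P (site_event P i (Item a) c))"
  by (simp add: run_def)

lemma run_quiescent: "run P xs = Some c \<Longrightarrow> in_flight c = []"
proof (cases xs rule: rev_cases)
  case Nil
  then show "run P xs = Some c \<Longrightarrow> ?thesis" by (auto simp: run_Nil init_def)
next
  case (snoc ys x)
  then show "run P xs = Some c \<Longrightarrow> ?thesis"
    by (cases x) (auto simp: run_snoc bind_eq_Some_conv exchange_SomeD)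
qed

lemma run_append_cost_mono:
  "run P xs = Some c \<Longrightarrow> run P (xs @ ys) = Some c' \<Longrightarrow> total_cost c \<le> total_cost c'"
proof (induction ys arbitrary: c' rule: rev_induct)
  case (snoc y ys)
  obtain a i where y: "y = (a, i)" by (cases y)
  from snoc.prems(2) obtain d where d: "run P (xs @ ys) = Some d"
    and ex: "exchange P (site_event P i (Item a) d) = Some c'"
    unfolding y append_assoc[symmetric] run_snoc by (auto simp: bind_eq_Some_conv)
  have "total_cost d \<le> total_cost (site_event P i (Item a) d)"
    by (simp add: site_event_def transmit_def Let_def)
  with snoc.IH[OF snoc.prems(1) d] exchange_SomeD(2)[OF ex] show ?case by linarith
qed simp

section \<open>Arrivals that trigger no message, and arrivals that trigger one\<close>

lemma run_silent_item:
  assumes "run P xs = Some c" "site_send P i (site_hist c i @ [Item a]) = []"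
  shows "run P (xs @ [(a, i)]) =
    Some (c\<lparr>site_hist := (site_hist c)(i := site_hist c i @ [Item a])\<rparr>)"
  using assms run_quiescent[OF assms(1)]
  by (simp add: run_snoc site_event_def transmit_def Let_def exchange_quiescent)

text \<open>A message is a nonempty list of words, so each message sent costs at least one word.
  Counting messages therefore bounds the cost from below for every word size
  \<open>b\<close>.\<close>

lemma run_loud_item:
  assumes "well_formed k b P" "i \<in> {1..k}" "run P xs = Some c"
    "site_send P i (site_hist c i @ [Item a]) \<noteq> []" "run P (xs @ [(a, i)]) = Some c'"
  shows "total_cost c < total_cost c'"
proof -
  obtain m ms where ms: "site_send P i (site_hist c i @ [Item a]) = m # ms"
    using assms(4) by (cases "site_send P i (site_hist c i @ [Item a])") auto
  have "\<forall>m\<in>set (site_send P i (site_hist c i @ [Item a])). is_message b m"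
    using assms(1,2) unfolding well_formed_def by blast
  then have "length m > 0" by (simp add: ms is_message_def)
  then have "total_cost c < total_cost (site_event P i (Item a) c)"
    by (simp add: site_event_def transmit_def Let_def ms)
  also have "\<dots> \<le> total_cost c'"
    using assms(3,5) by (intro exchange_SomeD(2)) (simp add: run_snoc)
  finally show ?thesis .
qed

text \<open>Only the history of site \<open>i\<close> in \<open>c\<close> enters, so the property is
  unaffected by whatever happens at other sites. It covers each of the first \<open>q\<close>
  copies, not just the last one.\<close>

definition silent :: "protocol \<Rightarrow> config \<Rightarrow> nat \<Rightarrow> nat \<Rightarrow> nat \<Rightarrow> bool" where
  "silent P c a i q \<longleftrightarrow>
     (\<forall>s<q. site_send P i (site_hist c i @ replicate (Suc s) (Item a)) = [])"

lemma replicate_Suc_conv_snoc: "replicate (Suc q) z = replicate q z @ [z]"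
  by (simp add: replicate_append_same)

lemma run_silent:
  assumes "run P xs = Some c" "silent P c a i q"
  shows "run P (xs @ replicate q (a, i)) =
    Some (c\<lparr>site_hist := (site_hist c)(i := site_hist c i @ replicate q (Item a))\<rparr>)"
  using assms(2)
proof (induction q)
  case 0
  then show ?case using assms(1) by simp
next
  case (Suc q)
  then have "silent P c a i q" by (simp add: silent_def)
  note run = Suc.IH[OF this]
  have "site_send P i (site_hist c i @ replicate (Suc q) (Item a)) = []"
    using Suc.prems unfolding silent_def by blast
  then show ?case
    using run_silent_item[OF run, of i a] by (simp add: replicate_Suc_conv_snoc fun_upd_def del: replicate_Suc cong: if_cong)
qed

text \<open>A silent block changes only the history of its own site, so the remaining sites stay
  silent when their blocks arrive. Nothing ever reaches the coordinator, which cannot tell the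
  extended run from \<open>c\<close>.\<close>

lemma run_silent_sites:
  assumes "distinct js" "run P xs = Some c" "\<forall>i\<in>set js. silent P c a i q"
  shows "\<exists>c'. run P (xs @ concat (map (\<lambda>i. replicate q (a, i)) js)) = Some c' \<and>
    coord_hist c' = coord_hist c"
  using assms
proof (induction js arbitrary: xs c)
  case (Cons j js)
  let ?d = "c\<lparr>site_hist := (site_hist c)(j := site_hist c j @ replicate q (Item a))\<rparr>"
  have run: "run P (xs @ replicate q (a, j)) = Some ?d"
    using Cons.prems by (intro run_silent) auto
  have "\<forall>i\<in>set js. silent P ?d a i q"
    using Cons.prems by (auto simp: silent_def)
  from Cons.IH[OF _ run this] Cons.prems(1) show ?case by simp
qed auto

subsection \<open>Two-valued inputs\<close>

text \<open>On the values 1 and 2, \<open>3 - x\<close> is the opposite value. An \<open>x\<close>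
  above 2 would have all items below it and force \<phi> \<ge> 1. For \<open>x\<close> = 1 the bound
  on greater items applies, for \<open>x\<close> = 2 the bound on smaller ones; \<phi> and 1 -
  \<phi> are both at most 1/2 + \<epsilon>.\<close>

lemma approx_median_two_valued:
  assumes med: "approx_median \<epsilon> u A x" and A: "set_mset A \<subseteq> {1, 2}" "A \<noteq> {#}" and "\<epsilon> < 1/2"
  shows "x \<in> {1, 2}" "real (count A (3 - x)) \<le> (1/2 + \<epsilon>) * real (size A)"
proof -
  obtain \<phi> where \<phi>: "1/2 - \<epsilon> \<le> \<phi>" "\<phi> \<le> 1/2 + \<epsilon>" and "1 \<le> x"
    and lo: "real (size {#y \<in># A. y < x#}) \<le> \<phi> * real (size A)"
    and hi: "real (size {#y \<in># A. x < y#}) \<le> (1 - \<phi>) * real (size A)"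
    using med by (auto simp: approx_median_def is_quantile_def)
  show x: "x \<in> {1, 2}"
  proof (rule ccontr)
    assume "x \<notin> {1, 2}"
    with \<open>1 \<le> x\<close> have "2 < x" by auto
    then have "{#y \<in># A. y < x#} = A"
      using A by (intro filter_mset_eq_conv[THEN iffD2]) auto
    with lo have "(1 - \<phi>) * real (size A) \<le> 0" by (simp add: algebra_simps)
    moreover have "0 < real (size A)" using A(2) by (simp add: nonempty_has_size)
    ultimately show False using \<phi> \<open>\<epsilon> < 1/2\<close> by (simp add: mult_le_0_iff)
  qed
  have bound: "r \<le> (1/2 + \<epsilon>) * real (size A)"
    if "r \<le> \<psi> * real (size A)" "\<psi> \<le> 1/2 + \<epsilon>" for r \<psi> :: real
    using that mult_right_mono[OF that(2), of "real (size A)"] by simp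
  from x consider "x = 1" | "x = 2" by auto
  then show "real (count A (3 - x)) \<le> (1/2 + \<epsilon>) * real (size A)"
  proof cases
    case 1
    have "{#y \<in># A. 1 < y#} = {#y \<in># A. y = 2#}"
      using A by (intro filter_mset_cong) auto
    then show ?thesis using hi \<phi> 1 bound[of _ "1 - \<phi>"] by (simp add: filter_eq_replicate_mset)
  next
    case 2
    have "{#y \<in># A. y < 2#} = {#y \<in># A. y = 1#}"
      using A by (intro filter_mset_cong) auto
    then show ?thesis using lo \<phi> 2 bound[of _ \<phi>] by (simp add: filter_eq_replicate_mset)
  qed
qed

abbreviation occ :: "nat \<Rightarrow> (nat \<times> nat) list \<Rightarrow> nat" where
  "occ v xs \<equiv> count (mset (map fst xs)) v"

lemma occ_two_valued:
  "set (map fst xs) \<subseteq> {1, 2} \<Longrightarrow> occ 1 xs + occ 2 xs = length xs"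
  by (induction xs) auto

lemma occ_blocks: "occ a (concat (map (\<lambda>i. replicate q (a, i)) js)) = length js * q"
  by (induction js) simp_all

lemma length_blocks: "length (concat (map (\<lambda>i. replicate q (a, i)) js)) = length js * q"
  by (induction js) simp_all

subsection \<open>The adversary\<close>

locale median_tracker =
  fixes k u b n :: nat and \<epsilon> :: real and P :: protocol
  assumes eps: "0 < \<epsilon>" "\<epsilon> < 1/4" and k: "2 \<le> k" and u: "2 \<le> u"
    and well_formed: "well_formed k b P" and tracks: "tracks_median k u \<epsilon> n P"
begin

text \<open>Tracking is stated for prefixes of inputs of length exactly \<open>n\<close>. Padding
  with arbitrary items makes any shorter list such a prefix.\<close>

lemma extend_to_inputs:
  assumes "set xs \<subseteq> {1, 2} \<times> {1..k}" "length xs \<le> n"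
  shows "xs @ replicate (n - length xs) (1, 1) \<in> inputs k u n"
  using assms u k by (auto simp: inputs_def)

lemma run_tracks:
  assumes "set xs \<subseteq> {1, 2} \<times> {1..k}" "length xs \<le> n"
  obtains c where "run P xs = Some c"
    "approx_median \<epsilon> u (mset (map fst xs)) (coord_out P (coord_hist c))"
proof -
  have "\<exists>c. run P (take (length xs) (xs @ replicate (n - length xs) (1, 1))) = Some c \<and>
      approx_median \<epsilon> u (mset (map fst (take (length xs) (xs @ replicate (n - length xs) (1, 1)))))
        (coord_out P (coord_hist c))"
    using tracks extend_to_inputs[OF assms] assms(2) unfolding tracks_median_def by blast
  then show ?thesis using that by auto
qed

lemma output_valid:
  assumes "set xs \<subseteq> {1, 2} \<times> {1..k}" "length xs \<le> n" "xs \<noteq> []"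
    "run P xs = Some c" "v = coord_out P (coord_hist c)"
  shows "v \<in> {1, 2}" "real (occ (3 - v) xs) \<le> (1/2 + \<epsilon>) * real (length xs)"
proof -
  have med: "approx_median \<epsilon> u (mset (map fst xs)) v"
    using run_tracks[OF assms(1,2)] assms(4,5) by auto
  have "set_mset (mset (map fst xs)) \<subseteq> {1, 2}" "mset (map fst xs) \<noteq> {#}"
    using assms(1,3) by auto
  from approx_median_two_valued[OF med this] eps
  show "v \<in> {1, 2}" "real (occ (3 - v) xs) \<le> (1/2 + \<epsilon>) * real (length xs)" by auto
qed

text \<open>The invariant of the adversary. As the two counts add up to the length m, each is also
  at least (1/2 - \<epsilon>) m - 1, so either value is close to becoming invalid. The slack 1 pays
  for the item that triggers a message, after which the coordinator may change its output.\<close>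

definition balanced :: "(nat \<times> nat) list \<Rightarrow> bool" where
  "balanced xs \<longleftrightarrow> xs \<noteq> [] \<and> set xs \<subseteq> {1, 2} \<times> {1..k} \<and>
     (\<forall>v\<in>{1, 2}. real (occ v xs) \<le> (1/2 + \<epsilon>) * real (length xs) + 1)"

text \<open>If all sites were silent, the output would still be \<open>v\<close> after
  \<open>k * q\<close> copies of \<open>3 - v\<close>. With m the old length, there are then at
  least (1/2 - \<epsilon>) m - 1 + k q copies of \<open>3 - v\<close>, while validity of
  \<open>v\<close> allows only (1/2 + \<epsilon>) (m + k q).\<close>

lemma some_site_not_silent:
  assumes bal: "balanced xs" and run: "run P xs = Some c"
    and v: "v = coord_out P (coord_hist c)"
    and q: "8 * \<epsilon> * real (length xs) + 4 < real (k * q)" and n: "length xs + k * q \<le> n"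
  shows "\<exists>i\<in>{1..k}. \<not> silent P c (3 - v) i q"
proof (rule ccontr)
  assume "\<not> ?thesis"
  then have silent: "\<forall>i\<in>set [1..<Suc k]. silent P c (3 - v) i q" by auto
  define bs where "bs = concat (map (\<lambda>i. replicate q (3 - v, i)) [1..<Suc k])"
  have xs: "xs \<noteq> []" "set xs \<subseteq> {1, 2} \<times> {1..k}" using bal by (auto simp: balanced_def)
  have v12: "v \<in> {1, 2}" using output_valid(1)[OF xs(2) _ xs(1) run v] n by simp
  obtain c' where c': "run P (xs @ bs) = Some c'" "coord_hist c' = coord_hist c"
    using run_silent_sites[OF _ run silent] unfolding bs_def by (auto simp del: upt_Suc)
  have len: "length bs = k * q" by (simp only: bs_def length_blocks length_upt diff_Suc_1)
  have occ: "occ (3 - v) bs = k * q" by (simp only: bs_def occ_blocks length_upt diff_Suc_1)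
  have "set bs \<subseteq> {1, 2} \<times> {1..k}" using v12 by (auto simp: bs_def)
  with xs(2) have set: "set (xs @ bs) \<subseteq> {1, 2} \<times> {1..k}" by simp
  have valid: "real (occ (3 - v) (xs @ bs)) \<le> (1/2 + \<epsilon>) * real (length (xs @ bs))"
    by (rule output_valid(2)[OF set _ _ c'(1)]) (use n len xs(1) v c'(2) in auto)
  have "real (occ v xs) \<le> (1/2 + \<epsilon>) * real (length xs) + 1"
    using bal v12 unfolding balanced_def by blast
  moreover have "occ v xs + occ (3 - v) xs = length xs"
  proof -
    have "set (map fst xs) \<subseteq> {1, 2}" using xs(2) by auto
    from occ_two_valued[OF this] v12 show ?thesis by auto
  qed
  ultimately have "(1/2 - \<epsilon>) * real (length xs) - 1 \<le> real (occ (3 - v) xs)"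
    by (simp add: algebra_simps flip: of_nat_add)
  with valid have "(1/2 - \<epsilon>) * real (k * q) \<le> 2 * \<epsilon> * real (length xs) + 1"
    using occ len by (simp add: algebra_simps)
  \<comment> \<open>Since \<epsilon> < 1/4, the factor 1/2 - \<epsilon> exceeds 1/4. Multiplying by
    4 yields the threshold 8 \<epsilon> m + 4 assumed for \<open>k * q\<close>.\<close>
  moreover have "1/4 * real (k * q) \<le> (1/2 - \<epsilon>) * real (k * q)"
    using eps by (intro mult_right_mono) auto
  ultimately show False using q by linarith
qed

text \<open>Only the copies up to the first message, all at one site, are actually inserted. The
  room required in \<open>n\<close> is that for the hypothetical blocks at all \<open>k\<close>
  sites, on which the existence of a talking site rests.\<close>

lemma adversary_step:
  assumes bal: "balanced xs" and run: "run P xs = Some c"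
    and n: "(1 + 8 * \<epsilon>) * real (length xs) + 4 + real k \<le> real n"
  obtains ys c' where "balanced (xs @ ys)" "run P (xs @ ys) = Some c'"
    "real (length (xs @ ys)) \<le> (1 + 8 * \<epsilon> / real k) * real (length xs) + 3"
    "total_cost c < total_cost c'"
proof -
  \<comment> \<open>\<open>z\<close> is the threshold shared among the sites and \<open>q\<close>
    the least integer above it, so \<open>k * q\<close> exceeds the threshold, by at most
    \<open>k\<close>.\<close>
  define z where "z = (8 * \<epsilon> * real (length xs) + 4) / real k"
  define q where "q = Suc (nat \<lfloor>z\<rfloor>)"
  have kz: "real k * z = 8 * \<epsilon> * real (length xs) + 4" using k by (simp add: z_def)
  have "z \<ge> 0" using eps by (simp add: z_def)
  then have q: "z < real q" "real q \<le> z + 1"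
    unfolding q_def by linarith+
  have "real k * z < real k * real q" "real k * real q \<le> real k * (z + 1)"
    using q k by (auto intro!: mult_strict_left_mono mult_left_mono)
  then have kq: "8 * \<epsilon> * real (length xs) + 4 < real (k * q)"
      "real (k * q) \<le> 8 * \<epsilon> * real (length xs) + 4 + real k"
    using kz by (simp_all add: algebra_simps)
  have "real (length xs + k * q) \<le> real n"
    using kq(2) n by (simp add: algebra_simps)
  then have fits: "length xs + k * q \<le> n" by linarith
  define v where "v = coord_out P (coord_hist c)"
  have xs: "xs \<noteq> []" "set xs \<subseteq> {1, 2} \<times> {1..k}" using bal by (auto simp: balanced_def)
  have v12: "v \<in> {1, 2}" using output_valid(1)[OF xs(2) _ xs(1) run v_def] fits by simp
  obtain i where i: "i \<in> {1..k}" "\<not> silent P c (3 - v) i q"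
    using some_site_not_silent[OF bal run v_def kq(1) fits] by blast
  define loud where
    "loud s \<longleftrightarrow> site_send P i (site_hist c i @ replicate (Suc s) (Item (3 - v))) \<noteq> []" for s
  obtain r where "r < q" "loud r" using i(2) unfolding silent_def loud_def by blast
  \<comment> \<open>By minimality the first \<open>s\<close> copies are silent and copy number
    \<open>s + 1\<close> is the first to trigger a message.\<close>
  define s where "s = (LEAST s. loud s)"
  have loud_s: "loud s" unfolding s_def by (rule LeastI[of loud, OF \<open>loud r\<close>])
  have "s < q" using Least_le[of loud, OF \<open>loud r\<close>] \<open>r < q\<close> unfolding s_def by (rule le_less_trans)
  have silent: "silent P c (3 - v) i s"
    unfolding silent_def s_def using not_less_Least[of _ loud] unfolding loud_def by blast
  define zs where "zs = xs @ replicate s (3 - v, i)"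
  define ys where "ys = replicate s (3 - v, i) @ [(3 - v, i)]"
  have ys: "xs @ ys = zs @ [(3 - v, i)]" by (simp add: ys_def zs_def)
  define d where "d = c\<lparr>site_hist := (site_hist c)(i := site_hist c i @ replicate s (Item (3 - v)))\<rparr>"
  have d: "run P zs = Some d" unfolding zs_def d_def by (rule run_silent[OF run silent])
  have "q \<le> k * q" using k by simp
  moreover have "length (xs @ ys) = length xs + Suc s" by (simp add: ys_def)
  ultimately have len: "length (xs @ ys) \<le> n" using fits \<open>s < q\<close> by linarith
  have set: "set zs \<subseteq> {1, 2} \<times> {1..k}" "set (xs @ ys) \<subseteq> {1, 2} \<times> {1..k}"
    using xs(2) v12 i(1) by (auto simp: zs_def ys_def)
  obtain c' where c': "run P (xs @ ys) = Some c'" using run_tracks[OF set(2) len] by blast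
  have cost: "total_cost c < total_cost c'"
    using run_loud_item[OF well_formed i(1) d _ c'[unfolded ys]] loud_s
    by (simp add: d_def loud_def replicate_append_same)
  \<comment> \<open>Before the triggering copy the coordinator still holds \<open>v\<close>, so
    validity of \<open>v\<close> bounds the copies of \<open>3 - v\<close>; that last copy uses up
    the slack 1. The count of \<open>v\<close> does not change, while its allowance grows with the
    length.\<close>
  have "real (occ (3 - v) zs) \<le> (1/2 + \<epsilon>) * real (length zs)"
    by (rule output_valid(2)[OF set(1) _ _ d]) (use len ys xs(1) in \<open>auto simp: zs_def d_def v_def\<close>)
  also have "\<dots> \<le> (1/2 + \<epsilon>) * real (length (xs @ ys))"
    using eps by (intro mult_left_mono) (auto simp: ys)
  finally have "real (occ (3 - v) (xs @ ys)) \<le> (1/2 + \<epsilon>) * real (length (xs @ ys)) + 1"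
    by (simp add: ys)
  moreover have "real (occ v (xs @ ys)) \<le> (1/2 + \<epsilon>) * real (length (xs @ ys)) + 1"
  proof -
    have "v \<noteq> 3 - v" using v12 by auto
    then have "real (occ v (xs @ ys)) = real (occ v xs)" by (simp add: ys_def)
    also have "\<dots> \<le> (1/2 + \<epsilon>) * real (length xs) + 1"
      using bal v12 unfolding balanced_def by blast
    also have "\<dots> \<le> (1/2 + \<epsilon>) * real (length (xs @ ys)) + 1"
      using eps by (intro add_right_mono mult_left_mono) auto
    finally show ?thesis .
  qed
  ultimately have bal': "balanced (xs @ ys)"
    using v12 xs(1) set(2) unfolding balanced_def by fastforce
  have "real (length (xs @ ys)) \<le> real (length xs) + real q" using \<open>s < q\<close> by (simp add: ys_def)
  also have "\<dots> \<le> real (length xs) + (z + 1)" using q by simp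
  also have "\<dots> = (1 + 8 * \<epsilon> / real k) * real (length xs) + (4 / real k + 1)"
    by (simp add: z_def add_divide_distrib algebra_simps)
  \<comment> \<open>As k \<ge> 2, the additive term 4/k + 1 is at most 3.\<close>
  also have "\<dots> \<le> (1 + 8 * \<epsilon> / real k) * real (length xs) + 3"
    using k by (simp add: field_simps)
  finally show thesis using that bal' c' cost by blast
qed

text \<open>The bound solves the recurrence L(j+1) = (1 + \<beta>) L(j) + 3 with L(0) = 1: its fixed
  point is -3/\<beta>, and the distance to it grows by the factor 1 + \<beta>. Each of the j steps
  adds at least one word to the cost.\<close>

lemma adversary_iterate:
  defines "\<beta> \<equiv> 8 * \<epsilon> / real k"
  assumes "(1 + 8 * \<epsilon>) * ((1 + \<beta>) ^ j * (1 + 3 / \<beta>)) + 4 + real k \<le> real n"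
  shows "\<exists>xs c. balanced xs \<and> run P xs = Some c \<and> j \<le> total_cost c \<and>
    real (length xs) \<le> (1 + \<beta>) ^ j * (1 + 3 / \<beta>) - 3 / \<beta> \<and> length xs \<le> n"
  using assms(2)
proof (induction j)
  have \<beta>: "\<beta> > 0" using eps k by (simp add: \<beta>_def)
  case 0
  have "0 \<le> (1 + 8 * \<epsilon>) * (1 + 3 / \<beta>)" using eps \<beta> by simp
  then have n: "1 \<le> n" using 0 k by simp
  \<comment> \<open>A single item meets the invariant only because of the slack 1.\<close>
  have bal: "balanced [(1, 1)]" using eps k by (auto simp: balanced_def)
  then have "set [(1, 1)] \<subseteq> {1, 2} \<times> {1..k}" by (simp add: balanced_def)
  from run_tracks[OF this] n obtain c where "run P [(1, 1)] = Some c" by auto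
  then show ?case using bal n by force
next
  have \<beta>: "\<beta> > 0" using eps k by (simp add: \<beta>_def)
  case (Suc j)
  let ?K = "1 + 3 / \<beta>"
  have "(1 + \<beta>) ^ j * ?K \<le> (1 + \<beta>) ^ Suc j * ?K"
    using \<beta> by (intro mult_right_mono power_increasing) auto
  then have mono: "(1 + 8 * \<epsilon>) * ((1 + \<beta>) ^ j * ?K) \<le> (1 + 8 * \<epsilon>) * ((1 + \<beta>) ^ Suc j * ?K)"
    using eps by (intro mult_left_mono) auto
  with Suc.prems have "(1 + 8 * \<epsilon>) * ((1 + \<beta>) ^ j * ?K) + 4 + real k \<le> real n" by linarith
  from Suc.IH[OF this] obtain xs c where xs: "balanced xs" "run P xs = Some c"
    "j \<le> total_cost c" "real (length xs) \<le> (1 + \<beta>) ^ j * ?K - 3 / \<beta>" by blast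
  have "real (length xs) \<le> (1 + \<beta>) ^ j * ?K" using xs(4) \<beta> by (smt (verit) divide_pos_pos)
  then have "(1 + 8 * \<epsilon>) * real (length xs) \<le> (1 + 8 * \<epsilon>) * ((1 + \<beta>) ^ j * ?K)"
    using eps by (intro mult_left_mono) auto
  with mono Suc.prems have "(1 + 8 * \<epsilon>) * real (length xs) + 4 + real k \<le> real n" by linarith
  from adversary_step[OF xs(1,2) this] obtain ys c' where ys: "balanced (xs @ ys)"
    "run P (xs @ ys) = Some c'"
    "real (length (xs @ ys)) \<le> (1 + \<beta>) * real (length xs) + 3" "total_cost c < total_cost c'"
    unfolding \<beta>_def by blast
  have "(1 + \<beta>) * real (length xs) \<le> (1 + \<beta>) * ((1 + \<beta>) ^ j * ?K - 3 / \<beta>)"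
    using xs(4) \<beta> by (intro mult_left_mono) auto
  also have "\<dots> = (1 + \<beta>) ^ Suc j * ?K - 3 / \<beta> - 3" using \<beta> by (simp add: field_simps)
  finally have len: "real (length (xs @ ys)) \<le> (1 + \<beta>) ^ Suc j * ?K - 3 / \<beta>"
    using ys(3) by linarith
  have "1 * ((1 + \<beta>) ^ Suc j * ?K) \<le> (1 + 8 * \<epsilon>) * ((1 + \<beta>) ^ Suc j * ?K)"
    using eps \<beta> by (intro mult_right_mono) auto
  moreover have "0 < 3 / \<beta>" using \<beta> by simp
  ultimately have "real (length (xs @ ys)) \<le> real n" using len Suc.prems by linarith
  with ys len xs(3) show ?case by (intro exI[of _ "xs @ ys"] exI[of _ c']) auto
qed

section \<open>From the number of steps to a logarithmic lower bound\<close>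

lemma costly_input:
  defines "\<beta> \<equiv> 8 * \<epsilon> / real k"
  assumes n: "3 * (sqrt (real n) * (1 + 3 / \<beta>)) + 4 + real k \<le> real n"
    and ln: "4 * \<beta> \<le> ln (real n)"
  shows "\<exists>xs\<in>inputs k u n. \<exists>c. run P xs = Some c \<and> ln (real n) / (4 * \<beta>) \<le> real (total_cost c)"
proof -
  have \<beta>: "\<beta> > 0" using eps k by (simp add: \<beta>_def)
  \<comment> \<open>With this many steps, (1 + \<beta>)^j \<le> exp (\<beta> j) \<le> sqrt n, so the
    adversary's input has length O(sqrt n) for fixed \<beta> and fits into \<open>n\<close>
    items.\<close>
  define j where "j = nat \<lfloor>ln (real n) / (2 * \<beta>)\<rfloor>"
  have "0 < ln (real n)" using ln \<beta> by linarith
  then have n0: "0 < real n" by (cases "n = 0") auto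
  have ge: "0 \<le> ln (real n) / (2 * \<beta>)" using \<open>0 < ln (real n)\<close> \<beta> by simp
  have j: "real j \<le> ln (real n) / (2 * \<beta>)" "ln (real n) / (2 * \<beta>) - 1 \<le> real j"
    using ge unfolding j_def by linarith+
  have "(1 + \<beta>) ^ j \<le> exp \<beta> ^ j" using \<beta> by (intro power_mono) auto
  also have "\<dots> = exp (real j * \<beta>)" by (simp add: exp_of_nat_mult)
  also have "\<dots> \<le> exp (ln (real n) / 2)" using j(1) \<beta> by (simp add: field_simps)
  also have "\<dots> = sqrt (real n)" using n0 by (simp add: ln_sqrt[symmetric])
  finally have "(1 + \<beta>) ^ j * (1 + 3 / \<beta>) \<le> sqrt (real n) * (1 + 3 / \<beta>)"
    using \<beta> by (intro mult_right_mono) auto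
  moreover have "0 \<le> (1 + \<beta>) ^ j * (1 + 3 / \<beta>)" using \<beta> by simp
  \<comment> \<open>The factor 3 arises from 1 + 8 \<epsilon> < 3.\<close>
  ultimately have "(1 + 8 * \<epsilon>) * ((1 + \<beta>) ^ j * (1 + 3 / \<beta>)) \<le> 3 * (sqrt (real n) * (1 + 3 / \<beta>))"
    using eps by (intro mult_mono[of _ _ "(1 + \<beta>) ^ j * (1 + 3 / \<beta>)"]) auto
  with n have "(1 + 8 * \<epsilon>) * ((1 + \<beta>) ^ j * (1 + 3 / \<beta>)) + 4 + real k \<le> real n" by linarith
  from adversary_iterate[OF this[unfolded \<beta>_def]] obtain xs c where xs: "balanced xs"
    "run P xs = Some c" "j \<le> total_cost c" "length xs \<le> n" by blast
  \<comment> \<open>Padding to length \<open>n\<close> cannot lower the cost already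
    incurred.\<close>
  let ?ys = "replicate (n - length xs) (1, 1)"
  have inp: "xs @ ?ys \<in> inputs k u n"
    using xs by (intro extend_to_inputs) (auto simp: balanced_def)
  have "set (xs @ ?ys) \<subseteq> {1, 2} \<times> {1..k}" "length (xs @ ?ys) \<le> n"
    using xs k by (auto simp: balanced_def)
  then obtain c' where c': "run P (xs @ ?ys) = Some c'" using run_tracks by blast
  \<comment> \<open>The 1 lost by rounding \<open>j\<close> down is absorbed by giving up half of
    the main term, by assumption \<open>ln\<close>.\<close>
  have "ln (real n) / (4 * \<beta>) \<le> ln (real n) / (2 * \<beta>) - 1"
    using ln \<beta> by (simp add: field_simps)
  also have "\<dots> \<le> real (total_cost c')"
    using j(2) xs(3) run_append_cost_mono[OF xs(2) c'] by linarith
  finally show ?thesis using inp c' by blast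
qed

end

theorem theorem4:
  shows "\<exists>\<epsilon>\<^sub>0>0. \<exists>C>0. \<forall>w :: nat \<Rightarrow> nat. (\<lambda>n. real (w n)) \<in> \<Theta>(\<lambda>n. ln (real n)) \<longrightarrow>
    (\<forall>(\<epsilon>::real) (k::nat). 0 < \<epsilon> \<and> \<epsilon> < \<epsilon>\<^sub>0 \<and> 2 \<le> k \<longrightarrow>
      (\<forall>\<^sub>F n in sequentially. \<forall>(u::nat) (P::protocol).
        2 \<le> u \<and> well_formed k (w n) P \<and> tracks_median k u \<epsilon> n P \<longrightarrow>
        (\<exists>xs\<in>inputs k u n. \<exists>c. run P xs = Some c \<and>
          real (total_cost c) \<ge> C * (real k / \<epsilon> * ln (real n)))))"
\<comment> \<open>The constant 1/32 is that of ln n / (4 \<beta>) with \<beta> = 8 \<epsilon> /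
  k.\<close>
proof (rule exI[of _ "1/4"], rule conjI, simp, rule exI[of _ "1/32"], intro conjI allI impI)
  fix w :: "nat \<Rightarrow> nat" and \<epsilon> :: real and k :: nat
  assume "0 < \<epsilon> \<and> \<epsilon> < 1/4 \<and> 2 \<le> k"
  then have eps: "0 < \<epsilon>" "\<epsilon> < 1/4" and k: "2 \<le> k" by auto
  define \<beta> where "\<beta> = 8 * \<epsilon> / real k"
  have "\<beta> > 0" using eps k by (simp add: \<beta>_def)
  then have "1 + 3 / \<beta> > 0" by (simp add: add_pos_pos)
  \<comment> \<open>\<epsilon> and k are fixed here, so the coefficient of the square root is a
    constant and the linear term eventually dominates.\<close>
  then have "\<forall>\<^sub>F n in sequentially. 3 * (sqrt (real n) * (1 + 3 / \<beta>)) + 4 + real k \<le> real n"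
    by real_asymp
  moreover have "\<forall>\<^sub>F n in sequentially. 4 * \<beta> \<le> ln (real n)"
    by real_asymp
  ultimately show "\<forall>\<^sub>F n in sequentially. \<forall>u P.
        2 \<le> u \<and> well_formed k (w n) P \<and> tracks_median k u \<epsilon> n P \<longrightarrow>
        (\<exists>xs\<in>inputs k u n. \<exists>c. run P xs = Some c \<and>
          real (total_cost c) \<ge> 1/32 * (real k / \<epsilon> * ln (real n)))"
  proof eventually_elim
    case (elim n)
    show ?case
    proof (intro allI impI)
      fix u P
      assume "2 \<le> u \<and> well_formed k (w n) P \<and> tracks_median k u \<epsilon> n P"
      then interpret median_tracker k u "w n" n \<epsilon> P
        using eps k by unfold_locales auto
      have "ln (real n) / (4 * (8 * \<epsilon> / real k)) = 1/32 * (real k / \<epsilon> * ln (real n))"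
        by simp
      then show "\<exists>xs\<in>inputs k u n. \<exists>c. run P xs = Some c \<and>
          real (total_cost c) \<ge> 1/32 * (real k / \<epsilon> * ln (real n))"
        using costly_input elim unfolding \<beta>_def by metis
    qed
  qed
qed simp_all

end
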